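(* Suppose the ideal-sensor (IS) assumption holds: $P(\boldsymbol x=\boldsymbol 1_K|\mathcal H_1)=P(\boldsymbol x=\boldsymbol 0_K|\mathcal H_0)=1$. Then: (1) the IGMM statistic $\Lambda_{\mathrm{IGMM}}$ is statistically equivalent to the IS statistic $\Lambda_{\mathrm{IS}}$, and thus attains optimum performance, i.e. that of the log-likelihood ratio $\Lambda_{\mathrm{opt}}(\boldsymbol y)=\ln\frac{p(\boldsymbol y|\mathcal H_1)}{p(\boldsymbol y|\mathcal H_0)}$ (to which $\Lambda_{\mathrm{IS}}$ is statistically equivalent under the IS assumption); (2) the two widely-linear statistics $\Lambda_{\mathrm{WL},0}$ and $\Lambda_{\mathrm{WL},1}$ are statistically equivalent to each other, and are given (up to statistical equivalence) by the sole widely-linear part $2\,\Re(\bar{\boldsymbol\mu}^\dagger\boldsymbol y)$ of $\Lambda_{\mathrm{IS}}$.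
   Context: Model. Fix integers $K,N\ge1$. For $i\in\{0,1\}$, under hypothesis $\mathcal H_i$ a random vector $\boldsymbol x\in\{0,1\}^K$ has joint pmf $P(\boldsymbol x|\mathcal H_i)$; put $P_{i,k}=P(x_k=1|\mathcal H_i)$, $\boldsymbol\rho_i=[P_{i,1},\dots,P_{i,K}]^T$ and let $\boldsymbol\Sigma_{\boldsymbol x|\mathcal H_i}$ be the covariance matrix of $\boldsymbol x$ under $\mathcal H_i$. The received vector is $\boldsymbol y=\sum_{k=1}^K\sqrt{\beta_k}\,\big(b_k\,\boldsymbol a(\theta_k)+\sqrt{1-b_k^2}\,\boldsymbol h_k\big)x_k+\boldsymbol w\in\mathbb C^N$, where $\beta_k>0$, $\boldsymbol a(\theta_k)\in\mathbb C^N$ are known vectors, $b_k=\sqrt{\kappa_k/(1+\kappa_k)}$ with Rician factor $\kappa_k\ge0$, the $\boldsymbol h_k$ are i.i.d. circular complex Gaussian $\mathcal N_{\mathbb C}(\boldsymbol 0,\boldsymbol I_N)$, $\boldsymbol w\sim\mathcal N_{\mathbb C}(\boldsymbol 0,\sigma_w^2\boldsymbol I_N)$ with $\sigma_w^2>0$, and $\boldsymbol x$, $(\boldsymbol h_k)_k$, $\boldsymbol w$ are independent. $p(\boldsymbol y|\mathcal H_i)$ denotes the resulting pdf of $\boldsymbol y$ under $\mathcal H_i$: explicitly, $p(\boldsymbol y|\mathcal H_i)=\sum_{\boldsymbol x\in\{0,1\}^K}P(\boldsymbol x|\mathcal H_i)\,\frac{1}{(\pi\sigma_e^2(\boldsymbol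 x))^N}\exp\!\Big(-\frac{\|\boldsymbol y-\sum_k\boldsymbol\mu_kx_k\|^2}{\sigma_e^2(\boldsymbol x)}\Big)$ with the notation below. Notation. $\boldsymbol\mu_k=\sqrt{\beta_k}\,b_k\,\boldsymbol a(\theta_k)$, $\nu_k=\beta_k(1-b_k^2)$, $\sigma_e^2(\boldsymbol x)=\sigma_w^2+\sum_k\nu_kx_k$, $\bar{\boldsymbol\mu}=\frac1K\sum_k\boldsymbol\mu_k$, $\bar\nu=\frac1K\sum_k\nu_k$; $\widetilde{\boldsymbol A}=[\boldsymbol\mu_1\cdots\boldsymbol\mu_K]\in\mathbb C^{N\times K}$; $\sigma_{e,i}^2=\sigma_w^2+\sum_k\nu_kP_{i,k}$. For a vector $\boldsymbol v$, the augmented vector $\underline{\boldsymbol v}$ stacks $\boldsymbol v$ on top of its entrywise conjugate $\boldsymbol v^*$; for a matrix $\boldsymbol A$, $\underline{\boldsymbol A}$ stacks $\boldsymbol A$ on top of $\boldsymbol A^*$. $(\cdot)^\dagger$ is conjugate transpose; $\boldsymbol 1_K,\boldsymbol 0_K$ are the all-ones and all-zeros vectors. $\boldsymbol\Sigma_{\underline{\boldsymbol y}|\mathcal H_i}=\underline{\widetilde{\boldsymbol A}}\,\boldsymbol\Sigma_{\boldsymbol x|\mathcal H_i}\,\underline{\widetilde{\boldsymbol A}}^\dagger+\sigma_{e,i}^2\boldsymbol I_{2N}$. Statistics. IS rule: $\Lambda_{\mathrm{IS}}(\boldsymbol y)=2\,\Re(\bar{\boldsymbol\mu}^\dagger\boldsymbol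 y)+\frac{\bar\nu}{\sigma_w^2}\|\boldsymbol y\|^2$. IGMM (improper Gaussian moment matching) rule: $\Lambda_{\mathrm{IGMM}}(\boldsymbol y)=-(\underline{\boldsymbol y}-\underline{\widetilde{\boldsymbol A}}\boldsymbol\rho_1)^\dagger\boldsymbol\Sigma_{\underline{\boldsymbol y}|\mathcal H_1}^{-1}(\underline{\boldsymbol y}-\underline{\widetilde{\boldsymbol A}}\boldsymbol\rho_1)+(\underline{\boldsymbol y}-\underline{\widetilde{\boldsymbol A}}\boldsymbol\rho_0)^\dagger\boldsymbol\Sigma_{\underline{\boldsymbol y}|\mathcal H_0}^{-1}(\underline{\boldsymbol y}-\underline{\widetilde{\boldsymbol A}}\boldsymbol\rho_0)$. Widely-linear (WL) rules, for $i\in\{0,1\}$: $\Lambda_{\mathrm{WL},i}(\boldsymbol y)=\underline{\boldsymbol z}_{\mathrm{WL},i}^\dagger\,\underline{\boldsymbol y}$ with $\underline{\boldsymbol z}_{\mathrm{WL},i}=\dfrac{\boldsymbol\Sigma_{\underline{\boldsymbol y}|\mathcal H_i}^{-1}\underline{\widetilde{\boldsymbol A}}(\boldsymbol\rho_1-\boldsymbol\rho_0)}{\big\|\boldsymbol\Sigma_{\underline{\boldsymbol y}|\mathcal H_i}^{-1}\underline{\widetilde{\boldsymbol A}}(\boldsymbol\rho_1-\boldsymbol\rho_0)\big\|}$ (the unit-norm maximizer of the deflection $(\mathbb E\{\Lambda|\mathcal H_1\}-\mathbb E\{\Lambda|\mathcal H_0\})^2/\mathrm{var}\{\Lambda|\mathcal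 H_i\}$ of $\Lambda=\underline{\boldsymbol z}^\dagger\underline{\boldsymbol y}$). Statistical equivalence. Two real-valued statistics of $\boldsymbol y$ are called statistically equivalent if they agree up to a positive multiplicative constant and an additive constant, neither depending on $\boldsymbol y$ (so threshold tests based on them are the same up to a change of threshold). *)

theory Defs
  imports "HOL-Probability.Probability"
begin

text \<open>
  The number of sensors is \<open>K = CARD('k)\<close> and the number of receive antennas is
  \<open>N = CARD('n)\<close>.  A vector of local decisions in \<open>{0,1}\<^sup>K\<close> is an element of
  \<^typ>\<open>bool^'k\<close>, where \<^const>\<open>True\<close> stands for 1.
\<close>

section \<open>Augmented vectors and conjugate transposes\<close>

definition cinner :: "complex^'m \<Rightarrow> complex^'m \<Rightarrow> complex" where
  "cinner u v = (\<Sum>i\<in>UNIV. cnj (u $ i) * v $ i)"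

definition ctranspose :: "complex^'c^'r \<Rightarrow> complex^'r^'c" where
  "ctranspose A = (\<chi> i j. cnj (A $ j $ i))"

definition aug_vec :: "complex^'n \<Rightarrow> complex^('n + 'n)" where
  "aug_vec v = (\<chi> i. case i of Inl j \<Rightarrow> v $ j | Inr j \<Rightarrow> cnj (v $ j))"

definition aug_mat :: "complex^'k^'n \<Rightarrow> complex^'k^('n + 'n)" where
  "aug_mat A = (\<chi> i k. case i of Inl j \<Rightarrow> A $ j $ k | Inr j \<Rightarrow> cnj (A $ j $ k))"


section \<open>Channel parameters\<close>

text \<open>
  \<open>gain C k\<close> is \<open>\<beta>\<^sub>k\<close>, \<open>rician C k\<close> is the Rician factor \<open>\<kappa>\<^sub>k\<close>, \<open>steering C k\<close> is
  \<open>a(\<theta>\<^sub>k)\<close>, and \<open>noise_var C\<close> is the variance \<open>\<sigma>\<^sub>w\<^sup>2\<close> itself (not its square root).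
\<close>

record ('k, 'n) channel =
  gain :: "'k \<Rightarrow> real"
  rician :: "'k \<Rightarrow> real"
  steering :: "'k \<Rightarrow> complex^'n"
  noise_var :: real

definition los :: "('k::finite, 'n::finite) channel \<Rightarrow> 'k \<Rightarrow> real" where
  "los C k = sqrt (rician C k / (1 + rician C k))"

definition mu :: "('k::finite, 'n::finite) channel \<Rightarrow> 'k \<Rightarrow> complex^'n" where
  "mu C k = (sqrt (gain C k) * los C k) *\<^sub>R steering C k"

definition nu :: "('k::finite, 'n::finite) channel \<Rightarrow> 'k \<Rightarrow> real" where
  "nu C k = gain C k * (1 - (los C k)\<^sup>2)"

definition mu_bar :: "('k::finite, 'n::finite) channel \<Rightarrow> complex^'n" where
  "mu_bar C = (1 / real CARD('k)) *\<^sub>R (\<Sum>k\<in>UNIV. mu C k)"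

definition nu_bar :: "('k::finite, 'n::finite) channel \<Rightarrow> real" where
  "nu_bar C = (1 / real CARD('k)) * (\<Sum>k\<in>UNIV. nu C k)"

definition A_tilde :: "('k::finite, 'n::finite) channel \<Rightarrow> complex^'k^'n" where
  "A_tilde C = (\<chi> j k. mu C k $ j)"

definition sigma_e2 :: "('k::finite, 'n::finite) channel \<Rightarrow> bool^'k \<Rightarrow> real" where
  "sigma_e2 C x = noise_var C + (\<Sum>k\<in>UNIV. nu C k * of_bool (x $ k))"


section \<open>Received vector and its density\<close>

text \<open>Density of the circular complex Gaussian law with mean \<open>m\<close> and covariance \<open>v I\<close>.\<close>

definition cgauss_density :: "complex^'n \<Rightarrow> real \<Rightarrow> complex^'n \<Rightarrow> real" where
  "cgauss_density m v y = 1 / (pi * v) ^ CARD('n) * exp (- (norm (y - m))\<^sup>2 / v)"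

definition cgauss :: "real \<Rightarrow> (complex^'n) measure" where
  "cgauss v = density lborel (\<lambda>z. ennreal (cgauss_density 0 v z))"

definition received ::
  "('k::finite, 'n::finite) channel \<Rightarrow> bool^'k \<Rightarrow> ('k \<Rightarrow> complex^'n) \<Rightarrow> complex^'n \<Rightarrow> complex^'n" where
  "received C x h w =
     (\<Sum>k\<in>UNIV. (sqrt (gain C k) * of_bool (x $ k)) *\<^sub>R
        (los C k *\<^sub>R steering C k + sqrt (1 - (los C k)\<^sup>2) *\<^sub>R h k)) + w"

text \<open>
  Law of the received vector when the decisions have joint pmf \<open>P\<close>; the product measure
  expresses that the decisions, the i.i.d. fading vectors and the noise are independent.
\<close>

definition received_law ::
  "('k::finite, 'n::finite) channel \<Rightarrow> (bool^'k) pmf \<Rightarrow> (complex^'n) measure" where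
  "received_law C P =
     distr (measure_pmf P \<Otimes>\<^sub>M (Pi\<^sub>M UNIV (\<lambda>_. cgauss 1) \<Otimes>\<^sub>M cgauss (noise_var C))) borel
       (\<lambda>(x, h, w). received C x h w)"

definition received_pdf ::
  "('k::finite, 'n::finite) channel \<Rightarrow> (bool^'k) pmf \<Rightarrow> complex^'n \<Rightarrow> real" where
  "received_pdf C P y =
     (\<Sum>x\<in>UNIV. pmf P x *
        cgauss_density (\<Sum>k\<in>UNIV. of_bool (x $ k) *\<^sub>R mu C k) (sigma_e2 C x) y)"


section \<open>Moments\<close>

definition prob_one :: "(bool^'k) pmf \<Rightarrow> 'k \<Rightarrow> real" where
  "prob_one P k = measure_pmf.prob P {x. x $ k}"

definition rho :: "(bool^'k) pmf \<Rightarrow> complex^'k" where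
  "rho P = (\<chi> k. complex_of_real (prob_one P k))"

definition Sigma_x :: "(bool^'k) pmf \<Rightarrow> complex^'k^'k" where
  "Sigma_x P = (\<chi> j k. complex_of_real
     (measure_pmf.expectation P
        (\<lambda>x. (of_bool (x $ j) - measure_pmf.expectation P (\<lambda>x. of_bool (x $ j))) *
             (of_bool (x $ k) - measure_pmf.expectation P (\<lambda>x. of_bool (x $ k))))))"

definition mean_sigma_e2 :: "('k::finite, 'n::finite) channel \<Rightarrow> (bool^'k) pmf \<Rightarrow> real" where
  "mean_sigma_e2 C P = noise_var C + (\<Sum>k\<in>UNIV. nu C k * prob_one P k)"

definition Sigma_y ::
  "('k::finite, 'n::finite) channel \<Rightarrow> (bool^'k) pmf \<Rightarrow> complex^('n + 'n)^('n + 'n)" where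
  "Sigma_y C P =
     aug_mat (A_tilde C) ** Sigma_x P ** ctranspose (aug_mat (A_tilde C))
       + mat (complex_of_real (mean_sigma_e2 C P))"


section \<open>Statistics\<close>

text \<open>
  Pmfs are passed in the order \<open>P0 P1\<close>, for the hypotheses \<open>H\<^sub>0\<close> and \<open>H\<^sub>1\<close>.  The statistics
  built from augmented vectors have values of type \<^typ>\<open>complex\<close>.
\<close>

definition Lambda_opt ::
  "('k::finite, 'n::finite) channel \<Rightarrow> (bool^'k) pmf \<Rightarrow> (bool^'k) pmf \<Rightarrow> complex^'n \<Rightarrow> real" where
  "Lambda_opt C P0 P1 y = ln (received_pdf C P1 y / received_pdf C P0 y)"

definition IS_linear_part :: "('k::finite, 'n::finite) channel \<Rightarrow> complex^'n \<Rightarrow> real" where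
  "IS_linear_part C y = 2 * Re (cinner (mu_bar C) y)"

definition Lambda_IS :: "('k::finite, 'n::finite) channel \<Rightarrow> complex^'n \<Rightarrow> real" where
  "Lambda_IS C y = IS_linear_part C y + nu_bar C / noise_var C * (norm y)\<^sup>2"

definition inv_quad_form ::
  "('k::finite, 'n::finite) channel \<Rightarrow> (bool^'k) pmf \<Rightarrow> complex^'n \<Rightarrow> complex" where
  "inv_quad_form C P y =
     (let e = aug_vec y - aug_mat (A_tilde C) *v rho P
      in cinner e (matrix_inv (Sigma_y C P) *v e))"

definition Lambda_IGMM ::
  "('k::finite, 'n::finite) channel \<Rightarrow> (bool^'k) pmf \<Rightarrow> (bool^'k) pmf \<Rightarrow> complex^'n \<Rightarrow> complex" where
  "Lambda_IGMM C P0 P1 y = - inv_quad_form C P1 y + inv_quad_form C P0 y"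

text \<open>
  The pmf \<open>P\<close> below selects the covariance matrix: \<open>P0\<close> and \<open>P1\<close> give the two widely-linear
  rules.  If the unnormalized vector is zero, so is \<open>z_WL\<close>, by \<open>inverse 0 = 0\<close>.
\<close>

definition z_WL ::
  "('k::finite, 'n::finite) channel \<Rightarrow> (bool^'k) pmf \<Rightarrow> (bool^'k) pmf \<Rightarrow> (bool^'k) pmf
     \<Rightarrow> complex^('n + 'n)" where
  "z_WL C P0 P1 P =
     (let u = matrix_inv (Sigma_y C P) *v (aug_mat (A_tilde C) *v (rho P1 - rho P0))
      in u /\<^sub>R norm u)"

definition Lambda_WL ::
  "('k::finite, 'n::finite) channel \<Rightarrow> (bool^'k) pmf \<Rightarrow> (bool^'k) pmf \<Rightarrow> (bool^'k) pmf
     \<Rightarrow> complex^'n \<Rightarrow> complex" where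
  "Lambda_WL C P0 P1 P y = cinner (z_WL C P0 P1 P) (aug_vec y)"


section \<open>Statistical equivalence and performance\<close>

definition stat_equiv :: "('y \<Rightarrow> real) \<Rightarrow> ('y \<Rightarrow> real) \<Rightarrow> bool" where
  "stat_equiv f g \<longleftrightarrow> (\<exists>c d. c > 0 \<and> (\<forall>y. f y = c * g y + d))"

text \<open>
  Performance of a statistic: all pairs of false-alarm and detection probabilities of the
  threshold tests deciding for \<open>H\<^sub>1\<close> when the statistic exceeds \<open>\<gamma>\<close>.
\<close>

definition roc ::
  "('k::finite, 'n::finite) channel \<Rightarrow> (bool^'k) pmf \<Rightarrow> (bool^'k) pmf \<Rightarrow> (complex^'n \<Rightarrow> real)
     \<Rightarrow> (real \<times> real) set" where
  "roc C P0 P1 f =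
     range (\<lambda>\<gamma>. (measure (received_law C P0) {y. f y > \<gamma>},
                 measure (received_law C P1) {y. f y > \<gamma>}))"

definition ideal_sensors :: "(bool^'k) pmf \<Rightarrow> (bool^'k) pmf \<Rightarrow> bool" where
  "ideal_sensors P0 P1 \<longleftrightarrow> pmf P1 (\<chi> k. True) = 1 \<and> pmf P0 (\<chi> k. False) = 1"

end

theory Submission
  imports Defs
begin

text \<open>
  Ideal sensors make the decisions deterministic under each hypothesis, so \<open>\<Sigma>\<^sub>x = 0\<close> and
  \<open>\<Sigma>\<^sub>y = s\<^sub>i I\<close> with \<open>s\<^sub>0 = \<sigma>\<^sub>w\<^sup>2\<close> and \<open>s\<^sub>1 = \<sigma>\<^sub>w\<^sup>2 + K \<nu>\<close>, where \<open>\<mu>\<close> and \<open>\<nu>\<close>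
  are the averages \<^const>\<open>mu_bar\<close> and \<^const>\<open>nu_bar\<close>.  Hence the IGMM statistic
  is twice \<open>D(y) = \<parallel>y\<parallel>\<^sup>2 / s\<^sub>0 - \<parallel>y - K \<mu>\<parallel>\<^sup>2 / s\<^sub>1\<close>, the log-likelihood ratio is \<open>D\<close> plus a
  constant, and since \<open>1 / s\<^sub>0 - 1 / s\<^sub>1 = K \<nu> / (s\<^sub>0 s\<^sub>1)\<close>, expanding the square shows that \<open>D\<close>
  is \<open>K / s\<^sub>1\<close> times the IS statistic plus a constant.  In the same way both widely-linear
  filters are nonnegative multiples of the augmented \<open>\<mu>\<close>.
\<close>

section \<open>Statistical equivalence and performance\<close>

lemma stat_equiv_sym:
  assumes "stat_equiv f g"
  shows "stat_equiv g f"
proof -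
  obtain c d where c: "c > 0" and fg: "\<And>y. f y = c * g y + d"
    using assms by (auto simp: stat_equiv_def)
  then have "\<forall>y. g y = 1 / c * f y + - d / c"
    by (simp add: field_simps)
  then show ?thesis
    unfolding stat_equiv_def using c by (metis zero_less_divide_1_iff)
qed

lemma stat_equiv_trans:
  assumes "stat_equiv f g" "stat_equiv g h"
  shows "stat_equiv f h"
proof -
  obtain c d where c: "c > 0" and fg: "\<And>y. f y = c * g y + d"
    using assms by (auto simp: stat_equiv_def)
  obtain c' d' where c': "c' > 0" and gh: "\<And>y. g y = c' * h y + d'"
    using assms by (auto simp: stat_equiv_def)
  have "\<forall>y. f y = (c * c') * h y + (c * d' + d)"
    by (simp add: fg gh algebra_simps)
  then show ?thesis
    unfolding stat_equiv_def using c c' by (metis mult_pos_pos)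
qed

text \<open>The positive affine relation turns the threshold \<open>\<gamma>\<close> for
  \<open>f\<close> into \<open>(\<gamma> - d) / c\<close> for \<open>g\<close>. One inclusion
  suffices, since the equivalence is symmetric.\<close>

lemma roc_subset_of_stat_equiv:
  assumes "stat_equiv f g"
  shows "roc C P0 P1 f \<subseteq> roc C P0 P1 g"
proof -
  obtain c d where "c > 0" and "\<And>y. f y = c * g y + d"
    using assms by (auto simp: stat_equiv_def)
  then have "{y. f y > \<gamma>} = {y. g y > (\<gamma> - d) / c}" for \<gamma>
    by (auto simp: field_simps)
  then show ?thesis
    unfolding roc_def by auto
qed

lemma roc_eq_of_stat_equiv: "stat_equiv f g \<Longrightarrow> roc C P0 P1 f = roc C P0 P1 g"
  by (simp add: roc_subset_of_stat_equiv stat_equiv_sym subset_antisym)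

section \<open>Scalar matrices and augmented vectors\<close>

lemma mat_of_real_vector_mul: "mat (complex_of_real c) *v v = c *\<^sub>R v"
  by (simp add: vec_eq_iff matrix_vector_mult_def mat_def if_distrib[of "\<lambda>x. x * _"]
      scaleR_conv_of_real[where 'a=complex] cong: if_cong)

text \<open>\<open>matrix_inv\<close> is a choice among two-sided inverses. The witness
  \<open>B\<close> shows that the choice is not empty, and associativity forces the chosen matrix to
  be \<open>B\<close>.\<close>

lemma matrix_inv_unique:
  fixes A B :: "'a::semiring_1^'m^'m"
  assumes "A ** B = mat 1" "B ** A = mat 1"
  shows "matrix_inv A = B"
proof -
  have "A ** matrix_inv A = mat 1 \<and> matrix_inv A ** A = mat 1"
    unfolding matrix_inv_def using assms
    by (intro someI_ex[of "\<lambda>X. A ** X = mat 1 \<and> X ** A = mat 1"]) blast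
  then show ?thesis
    using assms(1) by (metis matrix_mul_assoc matrix_mul_lid matrix_mul_rid)
qed

lemma matrix_inv_mat_of_real_vector_mul:
  fixes v :: "complex^'m"
  assumes "c \<noteq> 0"
  shows "matrix_inv (mat (complex_of_real c)) *v v = (1 / c) *\<^sub>R v"
proof -
  have "mat (complex_of_real a) ** (mat (complex_of_real b) :: complex^'m^'m) = mat 1"
    if "a * b = 1" for a b
    using that
    by (subst matrix_eq)
      (simp add: mat_of_real_vector_mul flip: matrix_vector_mul_assoc)
  then have "matrix_inv (mat (complex_of_real c) :: complex^'m^'m) = mat (complex_of_real (1 / c))"
    using assms by (intro matrix_inv_unique) (simp_all del: of_real_divide)
  then show ?thesis
    by (simp only: mat_of_real_vector_mul)
qed

lemma cinner_scaleR_left: "cinner (c *\<^sub>R u) v = complex_of_real c * cinner u v"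
  by (simp add: cinner_def scaleR_conv_of_real[where 'a=complex] sum_distrib_left mult_ac)

lemma cinner_scaleR_right: "cinner u (c *\<^sub>R v) = complex_of_real c * cinner u v"
  by (simp add: cinner_def scaleR_conv_of_real[where 'a=complex] sum_distrib_left mult_ac)

lemma Re_cinner: "Re (cinner u v) = inner u v"
  by (simp add: cinner_def inner_vec_def inner_complex_def)

text \<open>The conjugate half contributes the conjugate of the first half, so imaginary parts
  cancel. This is why the complex-typed statistics take real values.\<close>

lemma cinner_aug_vec: "cinner (aug_vec u) (aug_vec v) = complex_of_real (2 * inner u v)"
proof -
  have "cinner (aug_vec u) (aug_vec v) = cinner u v + cnj (cinner u v)"
    by (simp add: cinner_def aug_vec_def UNIV_Plus_UNIV[symmetric] sum.Plus
        del: UNIV_Plus_UNIV)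
  also have "\<dots> = complex_of_real (2 * inner u v)"
    by (simp add: complex_add_cnj Re_cinner)
  finally show ?thesis .
qed

lemma aug_vec_diff: "aug_vec u - aug_vec v = aug_vec (u - v)"
  by (simp add: vec_eq_iff aug_vec_def split: sum.split)

text \<open>Conjugation fixes a real vector, so it passes through the product onto the entries of
  \<open>A\<close>.\<close>

lemma aug_mat_mult_real_vector:
  "aug_mat A *v (\<chi> k. complex_of_real (f k)) = aug_vec (A *v (\<chi> k. complex_of_real (f k)))"
  by (simp add: vec_eq_iff aug_mat_def aug_vec_def matrix_vector_mult_def split: sum.split)

section \<open>Deterministic decisions\<close>

lemma pmf_eq_return_pmf:
  assumes "pmf P x = 1"
  shows "P = return_pmf x"
proof -
  have "AE y in measure_pmf P. y \<in> {x}"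
    using assms by (subst measure_pmf.AE_in_set_eq_1) (auto simp: measure_pmf_single)
  then show ?thesis
    by (auto simp: AE_measure_pmf_iff set_pmf_subset_singleton[symmetric])
qed

lemma prob_one_return: "prob_one (return_pmf x) k = of_bool (x $ k)"
  by (simp add: prob_one_def indicator_def)

text \<open>A deterministic decision vector has zero covariance, which leaves only the scalar noise
  term.\<close>

lemma Sigma_y_return:
  fixes C :: "('k::finite, 'n::finite) channel"
  shows "Sigma_y C (return_pmf x) = mat (complex_of_real (mean_sigma_e2 C (return_pmf x)))"
proof -
  have "Sigma_x (return_pmf x) = 0"
    by (simp add: Sigma_x_def vec_eq_iff)
  moreover have "M ** (0 :: complex^'k^'k) = 0" "(0 :: complex^'k^('n + 'n)) ** M' = 0"
    for M :: "complex^'k^('n + 'n)" and M' :: "complex^('n + 'n)^'k"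
    by (simp_all add: matrix_matrix_mult_def vec_eq_iff)
  ultimately show ?thesis
    by (simp add: Sigma_y_def)
qed

lemma received_pdf_return:
  "received_pdf C (return_pmf x) y =
     cgauss_density (\<Sum>k\<in>UNIV. of_bool (x $ k) *\<^sub>R mu C k) (sigma_e2 C x) y"
  by (simp add: received_pdf_def pmf_return indicator_def
      if_distrib[of "\<lambda>p. p * _"] cong: if_cong)

text \<open>The powers of \<open>pi\<close> cancel in the ratio of normalizing factors, and the
  variances leave a term independent of \<open>y\<close>.\<close>

lemma ln_cgauss_density_ratio:
  fixes m m' y :: "complex^'n"
  assumes "v > 0" "v' > 0"
  shows "ln (cgauss_density m v y / cgauss_density m' v' y) =
    real CARD('n) * ln (v' / v) - (norm (y - m))\<^sup>2 / v + (norm (y - m'))\<^sup>2 / v'"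
  using assms
  by (simp add: cgauss_density_def ln_div ln_mult ln_realpow algebra_simps)

section \<open>Averaged channel parameters and the IS statistic\<close>

lemma nu_nonneg:
  assumes "gain C k > 0" "rician C k \<ge> 0"
  shows "nu C k \<ge> 0"
  \<comment> \<open>The factor \<open>1 - (los C k)\<^sup>2\<close> equals
    \<open>1 / (1 + rician C k)\<close>.\<close>
  using assms by (simp add: nu_def los_def)

lemma sum_mu: "(\<Sum>k\<in>UNIV. mu C k) = real CARD('k) *\<^sub>R mu_bar C"
  for C :: "('k::finite, 'n::finite) channel"
  by (simp add: mu_bar_def)

lemma sum_nu: "(\<Sum>k\<in>UNIV. nu C k) = real CARD('k) * nu_bar C"
  for C :: "('k::finite, 'n::finite) channel"
  by (simp add: nu_bar_def)

lemma IS_linear_part_eq: "IS_linear_part C y = 2 * inner (mu_bar C) y"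
  by (simp add: IS_linear_part_def Re_cinner)

lemma quadratic_difference_eq_Lambda_IS:
  fixes C :: "('k::finite, 'n::finite) channel" and y :: "complex^'n"
  defines "s0 \<equiv> noise_var C" and "s1 \<equiv> noise_var C + real CARD('k) * nu_bar C"
  assumes "s0 > 0" "s1 > 0"
  shows "(norm y)\<^sup>2 / s0 - (norm (y - real CARD('k) *\<^sub>R mu_bar C))\<^sup>2 / s1 =
    real CARD('k) / s1 * Lambda_IS C y - (norm (real CARD('k) *\<^sub>R mu_bar C))\<^sup>2 / s1"
proof -
  have "(norm (y - real CARD('k) *\<^sub>R mu_bar C))\<^sup>2 =
      (norm y)\<^sup>2 - 2 * (real CARD('k) * inner (mu_bar C) y) + (norm (real CARD('k) *\<^sub>R mu_bar C))\<^sup>2"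
    unfolding power2_norm_eq_inner by (simp add: inner_diff inner_commute)
  then have "(norm (y - real CARD('k) *\<^sub>R mu_bar C))\<^sup>2 / s1 =
      (norm y)\<^sup>2 / s1 - real CARD('k) / s1 * IS_linear_part C y
        + (norm (real CARD('k) *\<^sub>R mu_bar C))\<^sup>2 / s1"
    by (simp only: add_divide_distrib diff_divide_distrib IS_linear_part_eq) simp
  moreover have "(norm y)\<^sup>2 / s0 - (norm y)\<^sup>2 / s1 =
      real CARD('k) / s1 * (nu_bar C / s0 * (norm y)\<^sup>2)"
    using assms(3,4) by (simp add: field_simps) (simp add: s0_def s1_def algebra_simps)
  ultimately show ?thesis
    unfolding Lambda_IS_def s0_def[symmetric] distrib_left by linarith
qed

lemma inv_quad_form_return:
  assumes "mean_sigma_e2 C (return_pmf x) > 0"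
  shows "inv_quad_form C (return_pmf x) y =
    complex_of_real (2 * (norm (y - A_tilde C *v rho (return_pmf x)))\<^sup>2
      / mean_sigma_e2 C (return_pmf x))"
  using assms
  by (simp add: inv_quad_form_def Let_def Sigma_y_return matrix_inv_mat_of_real_vector_mul rho_def aug_mat_mult_real_vector aug_vec_diff cinner_scaleR_right
      cinner_aug_vec power2_norm_eq_inner)

section \<open>Widely-linear statistics\<close>

lemma Lambda_WL_return:
  fixes C :: "('k::finite, 'n::finite) channel"
  assumes "mean_sigma_e2 C (return_pmf x) > 0"
    and "aug_mat (A_tilde C) *v (rho P1 - rho P0) = aug_vec (real CARD('k) *\<^sub>R mu_bar C)"
  obtains c where "c > 0"
    "\<And>y. Lambda_WL C P0 P1 (return_pmf x) y = complex_of_real (c * IS_linear_part C y)"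
proof -
  let ?m = "real CARD('k) *\<^sub>R mu_bar C"
  define s where "s = mean_sigma_e2 C (return_pmf x)"
  have s: "s > 0"
    using assms by (simp add: s_def)
  define u where "u = (1 / s) *\<^sub>R aug_vec ?m"
  have "z_WL C P0 P1 (return_pmf x) = u /\<^sub>R norm u"
    using s unfolding z_WL_def assms(2) Sigma_y_return s_def[symmetric] u_def
    by (simp only: matrix_inv_mat_of_real_vector_mul Let_def)
  moreover have "cinner u (aug_vec y) =
      complex_of_real (real CARD('k) / s * IS_linear_part C y)" for y
    by (simp add: u_def cinner_scaleR_left cinner_aug_vec IS_linear_part_eq)
  ultimately have WL: "Lambda_WL C P0 P1 (return_pmf x) y =
      complex_of_real (inverse (norm u) * (real CARD('k) / s) * IS_linear_part C y)" for y
    by (simp add: Lambda_WL_def cinner_scaleR_left)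
  show thesis
  proof (cases "u = 0")
    \<comment> \<open>Here normalization yields the zero filter, so the factor in \<open>WL\<close>
      is not positive. But \<open>mu_bar C\<close> vanishes too, both sides are identically zero,
      and any positive constant, such as 1, works.\<close>
    case True
    then have "cinner (aug_vec ?m) (aug_vec ?m) = 0"
      using s by (simp add: u_def cinner_def)
    then have "mu_bar C = 0"
      by (simp add: cinner_aug_vec)
    with that[of 1] WL True show thesis
      by (simp add: IS_linear_part_eq)
  next
    case False
    with that[OF _ WL] s show thesis
      by simp
  qed
qed

theorem lemma3:
  fixes C :: "('k::finite, 'n::finite) channel"
    and P0 P1 :: "(bool^'k) pmf"
  assumes "\<And>k. gain C k > 0"
    and "\<And>k. rician C k \<ge> 0"
    and "noise_var C > 0"
    and "ideal_sensors P0 P1"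
  shows "((\<forall>y. Lambda_IGMM C P0 P1 y \<in> \<real>) \<and>
          stat_equiv (\<lambda>y. Re (Lambda_IGMM C P0 P1 y)) (Lambda_IS C) \<and>
          stat_equiv (Lambda_IS C) (Lambda_opt C P0 P1) \<and>
          stat_equiv (\<lambda>y. Re (Lambda_IGMM C P0 P1 y)) (Lambda_opt C P0 P1) \<and>
          roc C P0 P1 (\<lambda>y. Re (Lambda_IGMM C P0 P1 y)) = roc C P0 P1 (Lambda_opt C P0 P1)) \<and>
         ((\<forall>P\<in>{P0, P1}. \<forall>y. Lambda_WL C P0 P1 P y \<in> \<real>) \<and>
          stat_equiv (\<lambda>y. Re (Lambda_WL C P0 P1 P0 y)) (\<lambda>y. Re (Lambda_WL C P0 P1 P1 y)) \<and>
          (\<forall>P\<in>{P0, P1}. stat_equiv (\<lambda>y. Re (Lambda_WL C P0 P1 P y)) (IS_linear_part C)))"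
proof -
  let ?K = "real CARD('k)"
  define m where "m = ?K *\<^sub>R mu_bar C"
  define s0 where "s0 = noise_var C"
  define s1 where "s1 = noise_var C + ?K * nu_bar C"
  have P: "P1 = return_pmf (\<chi> k. True)" "P0 = return_pmf (\<chi> k. False)"
    using assms(4) by (auto simp: ideal_sensors_def intro: pmf_eq_return_pmf)
  have s0: "s0 > 0"
    using assms(3) by (simp add: s0_def)
  have "(\<Sum>k\<in>UNIV. nu C k) \<ge> 0"
    using assms(1,2) by (intro sum_nonneg nu_nonneg) auto
  then have s1: "s1 > 0"
    using assms(3) by (simp add: s1_def flip: sum_nu)
  have mse: "mean_sigma_e2 C P0 = s0" "mean_sigma_e2 C P1 = s1"
    by (simp_all add: mean_sigma_e2_def P prob_one_return s0_def s1_def sum_nu)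
  have sig: "sigma_e2 C (\<chi> k. False) = s0" "sigma_e2 C (\<chi> k. True) = s1"
    by (simp_all add: sigma_e2_def s0_def s1_def sum_nu)
  \<comment> \<open>The constants stay under \<open>complex_of_real\<close> so that
    \<open>aug_mat_mult_real_vector\<close> matches.\<close>
  have rho: "rho P0 = (\<chi> k. complex_of_real 0)" "rho P1 = (\<chi> k. complex_of_real 1)"
    by (simp_all add: rho_def P prob_one_return)
  have A: "A_tilde C *v rho P0 = 0" "A_tilde C *v rho P1 = m"
    by (simp_all add: rho m_def A_tilde_def matrix_vector_mult_def vec_eq_iff flip: sum_mu)
  have "rho P1 - rho P0 = rho P1"
    by (simp add: rho vec_eq_iff)
  then have aug: "aug_mat (A_tilde C) *v (rho P1 - rho P0) = aug_vec m"
    using A by (simp add: rho aug_mat_mult_real_vector del: of_real_1 of_real_0)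

  have D: "(norm y)\<^sup>2 / s0 - (norm (y - m))\<^sup>2 / s1 = ?K / s1 * Lambda_IS C y - (norm m)\<^sup>2 / s1"
    for y
    using quadratic_difference_eq_Lambda_IS[of C y] s0 s1 by (simp add: m_def s0_def s1_def)

  \<comment> \<open>The IGMM statistic\<close>
  have q: "inv_quad_form C P0 y = complex_of_real (2 * (norm y)\<^sup>2 / s0)"
    "inv_quad_form C P1 y = complex_of_real (2 * (norm (y - m))\<^sup>2 / s1)" for y
    using inv_quad_form_return[of C "\<chi> k. False" y, folded P]
      inv_quad_form_return[of C "\<chi> k. True" y, folded P] s0 s1
    by (simp_all only: mse A diff_zero)
  have "Lambda_IGMM C P0 P1 y =
      complex_of_real (2 * ((norm y)\<^sup>2 / s0 - (norm (y - m))\<^sup>2 / s1))" for y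
    unfolding Lambda_IGMM_def q by (simp add: algebra_simps)
  then have IGMM: "Lambda_IGMM C P0 P1 y =
      complex_of_real (2 * ?K / s1 * Lambda_IS C y + - 2 * (norm m)\<^sup>2 / s1)" for y
    unfolding D by (simp add: algebra_simps)
  have IGMM_real: "\<forall>y. Lambda_IGMM C P0 P1 y \<in> \<real>"
    unfolding IGMM by (blast intro: Reals_of_real)
  have IGMM_IS: "stat_equiv (\<lambda>y. Re (Lambda_IGMM C P0 P1 y)) (Lambda_IS C)"
    unfolding stat_equiv_def IGMM Re_complex_of_real
    \<comment> \<open>The scale is positive because the finite index type is nonempty, so
      \<open>?K\<close> is at least 1.\<close>
    using s1 by (intro exI[of _ "2 * ?K / s1"] exI[of _ "- 2 * (norm m)\<^sup>2 / s1"]) simp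

  \<comment> \<open>The log-likelihood ratio\<close>
  have "Lambda_opt C P0 P1 y =
      ?K / s1 * Lambda_IS C y + (real CARD('n) * ln (s0 / s1) - (norm m)\<^sup>2 / s1)" for y
    using D[of y]
    by (simp add: Lambda_opt_def P received_pdf_return sig ln_cgauss_density_ratio s0 s1
        sum_mu m_def[symmetric])
  then have "stat_equiv (Lambda_opt C P0 P1) (Lambda_IS C)"
    unfolding stat_equiv_def using s1 by (intro exI[of _ "?K / s1"]
        exI[of _ "real CARD('n) * ln (s0 / s1) - (norm m)\<^sup>2 / s1"]) simp
  then have IS_opt: "stat_equiv (Lambda_IS C) (Lambda_opt C P0 P1)"
    by (rule stat_equiv_sym)
  with IGMM_IS have IGMM_opt: "stat_equiv (\<lambda>y. Re (Lambda_IGMM C P0 P1 y)) (Lambda_opt C P0 P1)"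
    by (rule stat_equiv_trans)

  \<comment> \<open>The choice of covariance only changes the positive scale, so both rules are
    compared through \<open>IS_linear_part C\<close>.\<close>
  have WL: "(\<forall>y. Lambda_WL C P0 P1 P y \<in> \<real>) \<and>
      stat_equiv (\<lambda>y. Re (Lambda_WL C P0 P1 P y)) (IS_linear_part C)" if "P \<in> {P0, P1}" for P
  proof -
    obtain x where x: "P = return_pmf x"
      using \<open>P \<in> {P0, P1}\<close> P by blast
    have "mean_sigma_e2 C P > 0"
      using \<open>P \<in> {P0, P1}\<close> mse s0 s1 by auto
    then obtain c where "c > 0"
      and c: "\<And>y. Lambda_WL C P0 P1 P y = complex_of_real (c * IS_linear_part C y)"
      using Lambda_WL_return[of C x P1 P0] aug unfolding x m_def by blast
    then have "stat_equiv (\<lambda>y. Re (Lambda_WL C P0 P1 P y)) (IS_linear_part C)"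
      unfolding stat_equiv_def by (intro exI[of _ c] exI[of _ 0]) simp
    then show ?thesis
      unfolding c by (blast intro: Reals_of_real)
  qed
  then have "stat_equiv (\<lambda>y. Re (Lambda_WL C P0 P1 P0 y)) (\<lambda>y. Re (Lambda_WL C P0 P1 P1 y))"
    by (blast intro: stat_equiv_trans stat_equiv_sym)
  with WL IGMM_real IGMM_IS IS_opt IGMM_opt roc_eq_of_stat_equiv[OF IGMM_opt] show ?thesis
    by blast
qed

end
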